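(* Let $q=2^m$ with $m\ge 1$, let $n\ge 1$ be an integer and let $a\in\mathbb F_{q^2}^*$ be such that $q\ge (2\max\{n,6-n\})^4$ and $a^{q+1}\ne 1$. Then $f(X)=X^n(X^{3(q-1)}+a)\in\mathbb F_{q^2}[X]$ is not a permutation binomial of $\mathbb F_{q^2}$.
   Context: $\mathbb F_{Q}$ denotes the finite field with $Q$ elements and $\mathbb F_Q^*$ its multiplicative group. A permutation binomial (PB) of $\mathbb F_Q$ is a polynomial of the form $\alpha X^{m}+\beta X^{k}$ with $\alpha,\beta\in\mathbb F_Q^*$, $m\not\equiv 0$, $k\not\equiv 0$ and $m\not\equiv k \pmod{Q-1}$, which induces a permutation of $\mathbb F_Q$. *)

theory Defs
  imports
    "HOL-Computational_Algebra.Polynomial"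
    "HOL-Number_Theory.Cong"
    "HOL-Library.Cardinality"
begin

definition binomial_poly :: "'a::{finite,field} poly \<Rightarrow> bool" where
  "binomial_poly f \<longleftrightarrow>
     (\<exists>\<alpha> \<beta> :: 'a. \<exists>m k :: nat.
        \<alpha> \<noteq> 0 \<and> \<beta> \<noteq> 0 \<and>
        \<not> [m = 0] (mod (CARD('a) - 1)) \<and>
        \<not> [k = 0] (mod (CARD('a) - 1)) \<and>
        \<not> [m = k] (mod (CARD('a) - 1)) \<and>
        f = monom \<alpha> m + monom \<beta> k)"

definition permutation_binomial :: "'a::{finite,field} poly \<Rightarrow> bool" where
  "permutation_binomial f \<longleftrightarrow> binomial_poly f \<and> bij (poly f)"

end

theory Submission
  imports Defs "HOL-Computational_Algebra.Primes"
begin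

text \<open>
  Hermite's criterion: if \<open>f\<close> permutes a field with \<open>q\<^sup>2\<close> elements, then the power sums
  \<open>\<Sum>x. f x ^ s\<close> vanish for \<open>0 < s < q\<^sup>2 - 1\<close>. Since \<open>3\<close> divides \<open>q\<^sup>2 - 1\<close>, cubing is not
  injective, which rules out \<open>3 dvd n\<close>. If \<open>q mod 3 = 1\<close>, the power sum for \<open>s = q - 1\<close> has exactly
  one nonzero term.

  If \<open>q mod 3 = 2\<close>, take \<open>s = (q - 1) * (P + 1)\<close> with \<open>P = 2 ^ e\<close>, \<open>e\<close> odd. In characteristic two
  \<open>(1 + v) ^ s = (1 + v ^ (q * P)) * (\<Sum>j. v ^ j)\<close>, where \<open>j\<close> runs over the numbers below \<open>q\<close> whose
  binary digit number \<open>e\<close> is zero. Only six exponents survive in the power sum, and with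
  \<open>B = a ^ (- (q + 1) / 3)\<close> its vanishing reads \<open>(1 + B ^ (3 * P)) * V = W\<close>, where \<open>W \<noteq> 0\<close> does not
  depend on \<open>P\<close> and \<open>V\<close> depends on \<open>P\<close> only through three binary digits. These digits are the same
  for \<open>P\<close> and \<open>4 * P\<close>, hence \<open>B ^ (3 * P) = B ^ (12 * P)\<close>. So the cube of \<open>a ^ (q + 1)\<close> is \<open>1\<close>,
  and as \<open>a ^ (q + 1)\<close> lies in the subfield with \<open>q\<close> elements and \<open>q - 1\<close> is prime to \<open>3\<close>,
  \<open>a ^ (q + 1) = 1\<close>.
\<close>

section \<open>Power sums over a finite field and Hermite's criterion\<close>

lemma nonzero_power_card_minus_one:
  fixes x :: "'a::{finite,field}"
  assumes "x \<noteq> 0"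
  shows "x ^ (CARD('a) - 1) = 1"
proof -
  have "(\<Prod>y\<in>UNIV - {0}. x * y) = (\<Prod>y\<in>UNIV - {0}. y)"
    by (rule prod.reindex_bij_witness[of _ "\<lambda>y. y / x" "\<lambda>y. x * y"]) (use assms in auto)
  moreover have "(\<Prod>y\<in>UNIV - {0::'a}. x * y) = x ^ (CARD('a) - 1) * \<Prod>(UNIV - {0})"
    by (simp add: prod.distrib)
  moreover have "\<Prod>(UNIV - {0::'a}) \<noteq> 0"
    by simp
  ultimately show ?thesis
    by simp
qed

lemma card_field_ge_two: "CARD('a::{finite,field}) \<ge> 2"
proof -
  have "card {0, 1 :: 'a} \<le> CARD('a)"
    by (intro card_mono) auto
  then show ?thesis
    by simp
qed

lemma of_nat_card_field: "of_nat CARD('a) = (0 :: 'a::{finite,field})"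
proof -
  have "(\<Sum>x\<in>UNIV. x + 1) = (\<Sum>x\<in>UNIV. x :: 'a)"
    by (rule sum.reindex_bij_witness[of _ "\<lambda>x. x - 1" "\<lambda>x. x + 1"]) auto
  then show ?thesis
    by (simp add: sum.distrib)
qed

text \<open>Otherwise, with \<open>r\<close> the residue of \<open>M\<close> modulo
  \<open>CARD('a) - 1\<close>, the nonzero polynomial \<open>X ^ r - 1\<close> would vanish at all
  \<open>CARD('a) - 1 > r\<close> nonzero elements.\<close>

lemma exists_power_neq_one:
  assumes "\<not> CARD('a) - 1 dvd M"
  obtains y :: "'a::{finite,field}" where "y \<noteq> 0" "y ^ M \<noteq> 1"
proof (rule ccontr)
  assume "\<not> thesis"
  with that have all: "y ^ M = 1" if "y \<noteq> 0" for y :: 'a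
    using that by blast
  define K where "K = CARD('a) - 1"
  define r where "r = M mod K"
  have K: "K > 0"
    using card_field_ge_two[where 'a = 'a] by (simp add: K_def)
  have r: "0 < r" "r < K"
    using assms K unfolding r_def K_def[symmetric] by (auto simp: dvd_eq_mod_eq_0)
  have root: "y ^ r = 1" if "y \<noteq> 0" for y :: 'a
  proof -
    have "y ^ M = y ^ (K * (M div K) + r)"
      by (simp add: r_def)
    also have "\<dots> = y ^ r"
      using nonzero_power_card_minus_one[OF that] by (simp add: power_add power_mult K_def)
    finally show ?thesis
      using all[OF that] by simp
  qed
  define p :: "'a poly" where "p = monom 1 r - 1"
  have deg: "degree p \<le> r"
    unfolding p_def by (rule degree_diff_le) (simp_all add: degree_monom_le)
  have "poly p 0 \<noteq> 0"
    using r by (simp add: p_def poly_monom power_0_left)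
  then have "p \<noteq> 0"
    by auto
  then have "card {x. poly p x = 0} \<le> r"
    using card_poly_roots_bound[of p] deg by simp
  moreover have "card (UNIV - {0 :: 'a}) \<le> card {x. poly p x = 0}"
    by (rule card_mono) (auto simp: p_def poly_monom root)
  ultimately show False
    using r by (simp add: K_def)
qed

text \<open>Scaling \<open>x\<close> by a nonzero \<open>y\<close> multiplies the sum by
  \<open>y ^ M\<close>, so the sum vanishes as soon as some \<open>y ^ M\<close> differs from 1.
  Positivity of \<open>M\<close> removes the term at 0, as \<open>0 ^ 0 = 1\<close>.\<close>

lemma sum_powers_field:
  assumes "M > 0"
  shows "(\<Sum>x\<in>UNIV. (x :: 'a::{finite,field}) ^ M) = (if CARD('a) - 1 dvd M then - 1 else 0)"
proof (cases "CARD('a) - 1 dvd M")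
  case True
  then obtain k where k: "M = (CARD('a) - 1) * k"
    by (auto simp: dvd_def)
  have "(\<Sum>x\<in>UNIV. (x :: 'a) ^ M) = (\<Sum>x\<in>UNIV - {0}. (x :: 'a) ^ M)"
    by (rule sum.mono_neutral_right) (use assms in auto)
  also have "\<dots> = (\<Sum>x\<in>UNIV - {0 :: 'a}. 1)"
    by (rule sum.cong) (use nonzero_power_card_minus_one[where 'a = 'a] in \<open>auto simp: k power_mult\<close>)
  also have "\<dots> = of_nat (CARD('a) - 1)"
    by simp
  also have "\<dots> = of_nat CARD('a) - 1"
    using card_field_ge_two[where 'a = 'a] by (simp add: of_nat_diff)
  also have "of_nat CARD('a) = (0 :: 'a)"
    by (rule of_nat_card_field)
  finally show ?thesis
    using True by simp
next
  case False
  then obtain y :: 'a where y: "y \<noteq> 0" "y ^ M \<noteq> 1"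
    by (rule exists_power_neq_one)
  have "(\<Sum>x\<in>UNIV. (y * x) ^ M) = (\<Sum>x\<in>UNIV. x ^ M)"
    by (rule sum.reindex_bij_witness[of _ "\<lambda>x. x / y" "\<lambda>x. y * x"]) (use y in auto)
  then have "y ^ M * (\<Sum>x\<in>UNIV. x ^ M) = (\<Sum>x\<in>UNIV. x ^ M)"
    by (simp add: power_mult_distrib sum_distrib_left)
  then show ?thesis
    using y False by simp
qed

text \<open>The necessary half of Hermite's criterion: a permutation only reorders the terms of a
  power sum.\<close>

lemma sum_powers_of_bij:
  fixes f :: "'a::{finite,field} \<Rightarrow> 'a"
  assumes "bij f" "0 < s" "s < CARD('a) - 1"
  shows "(\<Sum>x\<in>UNIV. f x ^ s) = 0"
proof -
  have "(\<Sum>x\<in>UNIV. f x ^ s) = (\<Sum>x\<in>UNIV. x ^ s)"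
    using sum.reindex_bij_betw[of f UNIV UNIV "\<lambda>x. x ^ s"] assms(1) by simp
  also have "\<dots> = 0"
    using assms(2,3) by (auto simp: sum_powers_field dest: dvd_imp_le)
  finally show ?thesis .
qed

text \<open>Hermite's criterion fails at \<open>s = (CARD('a) - 1) / 3\<close>, where the sum of all
  \<open>x ^ (3 * s)\<close> is -1.\<close>

lemma cubing_not_inj:
  assumes "3 dvd CARD('a) - 1"
  shows "\<not> inj (\<lambda>x :: 'a::{finite,field}. x ^ 3)"
proof
  assume "inj (\<lambda>x :: 'a. x ^ 3)"
  then have bij: "bij (\<lambda>x :: 'a. x ^ 3)"
    by (simp add: bij_def finite_UNIV_inj_surj)
  obtain s where s: "CARD('a) - 1 = 3 * s"
    using assms by (auto simp: dvd_def)
  then have "s > 0"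
    using card_field_ge_two[where 'a = 'a] by (intro Nat.gr0I) auto
  then have "(\<Sum>x\<in>UNIV. ((x :: 'a) ^ 3) ^ s) = 0"
    using s by (intro sum_powers_of_bij[OF bij]) linarith+
  then show False
    using \<open>s > 0\<close> sum_powers_field[of "3 * s", where 'a = 'a] s by (simp flip: power_mult)
qed

section \<open>Expansions in characteristic two and power sums of the binomial\<close>

lemma one_plus_power_two_power:
  fixes v :: "'a::{finite,field}"
  assumes "CHAR('a) = 2"
  shows "(1 + v) ^ (2 ^ k) = 1 + v ^ (2 ^ k)"
  using freshmans_dream'[where 'a = 'a, of "2 ^ k" k 1 v] assms by simp

text \<open>All binomial coefficients in row \<open>2 ^ k - 1\<close> are odd. In the induction the
  factor \<open>1 + v ^ (2 ^ k)\<close> puts a new leading binary digit on the exponents.\<close>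

lemma one_plus_power_mersenne:
  fixes v :: "'a::{finite,field}"
  assumes "CHAR('a) = 2"
  shows "(1 + v) ^ (2 ^ k - 1) = (\<Sum>j<2 ^ k. v ^ j)"
proof (induction k)
  case (Suc k)
  define L :: nat where "L = 2 ^ k"
  have "{..<2 * L} = {..<L} \<union> (\<lambda>j. L + j) ` {..<L}"
    using ivl_disj_un_one(2)[of L "2 * L"] image_add_atLeastLessThan[of L 0 L]
    by (simp add: mult_2 lessThan_atLeast0 add.commute)
  then have "(\<Sum>j<2 * L. v ^ j) = (\<Sum>j<L. v ^ j) + (\<Sum>j\<in>(\<lambda>j. L + j) ` {..<L}. v ^ j)"
    by (auto intro!: sum.union_disjoint)
  also have "(\<Sum>j\<in>(\<lambda>j. L + j) ` {..<L}. v ^ j) = v ^ L * (\<Sum>j<L. v ^ j)"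
    by (subst sum.reindex) (auto simp: power_add sum_distrib_left)
  finally have "(\<Sum>j<2 * L. v ^ j) = (1 + v ^ L) * (\<Sum>j<L. v ^ j)"
    by (simp add: algebra_simps)
  also have "\<dots> = (1 + v) ^ L * (1 + v) ^ (L - 1)"
    using Suc one_plus_power_two_power[OF assms, of v k] by (simp add: L_def)
  also have "\<dots> = (1 + v) ^ (2 * L - 1)"
    by (simp add: L_def mult_2 flip: power_add)
  finally show ?case
    by (simp add: L_def)
qed simp

text \<open>An instance of Lucas' theorem: the exponent on the left has all binary digits 1 except
  digit \<open>e\<close>, so \<open>j\<close> survives iff its own digit \<open>e\<close> is zero.
  The induction on \<open>d\<close> adds the digits above \<open>e\<close>.\<close>

lemma one_plus_power_mersenne_minus_bit:
  fixes v :: "'a::{finite,field}"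
  assumes "CHAR('a) = 2"
  shows "(1 + v) ^ (2 ^ (e + 1 + d) - 1 - 2 ^ e) =
    (\<Sum>j | j < 2 ^ (e + 1 + d) \<and> even (j div 2 ^ e). v ^ j)"
proof (induction d)
  case 0
  have "{j. j < 2 ^ (e + 1) \<and> even (j div 2 ^ e)} = {..<(2 :: nat) ^ e}"
  proof (intro set_eqI iffI)
    fix j :: nat
    assume "j \<in> {j. j < 2 ^ (e + 1) \<and> even (j div 2 ^ e)}"
    then have "j div 2 ^ e < 2" "even (j div 2 ^ e)"
      by (auto simp: div_less_iff_less_mult)
    then have "j div 2 ^ e = 0"
      by (cases "j div 2 ^ e") auto
    then show "j \<in> {..<2 ^ e}"
      by (simp add: div_eq_0_iff)
  qed auto
  then show ?case
    using one_plus_power_mersenne[OF assms, of v e] by (simp add: mult_2)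
next
  case (Suc d)
  define L P :: nat where "L = 2 ^ (e + 1 + d)" and "P = 2 ^ e"
  have LP: "L = P * (2 * 2 ^ d)" and P: "P > 0"
    by (simp_all add: L_def P_def power_add)
  define J where "J = {j. j < L \<and> even (j div P)}"
  have par: "even ((L + j) div P) = even (j div P)" for j
    using P by (simp add: LP)
  have "{j. j < 2 * L \<and> even (j div P)} = J \<union> (\<lambda>j. L + j) ` J"
  proof (intro set_eqI iffI)
    fix j
    assume j: "j \<in> {j. j < 2 * L \<and> even (j div P)}"
    show "j \<in> J \<union> (\<lambda>j. L + j) ` J"
    proof (cases "j < L")
      case True
      then show ?thesis
        using j by (simp add: J_def)
    next
      case False
      then have "j = L + (j - L)" "j - L \<in> J"
        using j par[of "j - L"] by (auto simp: J_def)
      then show ?thesis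
        by blast
    qed
  qed (auto simp: J_def par)
  moreover have "finite J" "J \<inter> (\<lambda>j. L + j) ` J = {}"
    by (auto simp: J_def)
  ultimately have "(\<Sum>j | j < 2 * L \<and> even (j div P). v ^ j) =
      (\<Sum>j\<in>J. v ^ j) + (\<Sum>j\<in>(\<lambda>j. L + j) ` J. v ^ j)"
    by (simp add: sum.union_disjoint)
  also have "(\<Sum>j\<in>(\<lambda>j. L + j) ` J. v ^ j) = v ^ L * (\<Sum>j\<in>J. v ^ j)"
    by (subst sum.reindex) (auto simp: power_add sum_distrib_left)
  also have "(\<Sum>j\<in>J. v ^ j) + v ^ L * (\<Sum>j\<in>J. v ^ j) = (1 + v ^ L) * (\<Sum>j\<in>J. v ^ j)"
    by (simp add: algebra_simps)
  also have "\<dots> = (1 + v) ^ L * (1 + v) ^ (L - 1 - P)"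
    using Suc one_plus_power_two_power[OF assms, of v "e + 1 + d"]
    by (simp add: L_def P_def J_def)
  also have "\<dots> = (1 + v) ^ (2 * L - 1 - P)"
  proof -
    have "P * 2 \<le> L"
      by (simp add: LP)
    then have "L + (L - 1 - P) = 2 * L - 1 - P"
      using P by linarith
    then show ?thesis
      by (simp flip: power_add)
  qed
  finally show ?case
    by (simp add: L_def P_def)
qed

text \<open>With exponent \<open>(q - 1) * t\<close>, each power of \<open>x\<close> in the
  expansion is \<open>(q - 1) * (n * t + 3 * j)\<close>, so divisibility by
  \<open>CARD('a) - 1 = (q - 1) * (q + 1)\<close> reduces to divisibility by \<open>q + 1\<close>.
  The set \<open>J\<close> records which coefficients are 1.\<close>

lemma sum_binomial_powers:
  fixes a :: "'a::{finite,field}"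
  assumes "CHAR('a) = 2" "CARD('a) = q\<^sup>2" "a \<noteq> 0" "n > 0" "t > 0" "q > 1"
    and J: "finite J" "\<And>v :: 'a. (1 + v) ^ ((q - 1) * t) = (\<Sum>j\<in>J. v ^ j)"
  shows "(\<Sum>x\<in>UNIV. (x ^ n * (x ^ (3 * (q - 1)) + a)) ^ ((q - 1) * t)) =
    a ^ ((q - 1) * t) * (\<Sum>j | j \<in> J \<and> q + 1 dvd n * t + 3 * j. inverse a ^ j)"
proof -
  define s where "s = (q - 1) * t"
  have s: "s > 0"
    using assms by (simp add: s_def)
  have card: "CARD('a) - 1 = (q - 1) * (q + 1)"
    using assms(2) by (simp add: power2_eq_square algebra_simps diff_mult_distrib)
  have dvd: "CARD('a) - 1 dvd n * s + 3 * (q - 1) * j \<longleftrightarrow> q + 1 dvd n * t + 3 * j" for j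
  proof -
    have "n * s + 3 * (q - 1) * j = (q - 1) * (n * t + 3 * j)"
      by (simp add: s_def algebra_simps)
    then show ?thesis
      using \<open>q > 1\<close> unfolding card by (simp only: nat_mult_dvd_cancel_disj) auto
  qed
  have power_sum: "(\<Sum>x\<in>UNIV. x ^ (n * s + 3 * (q - 1) * j)) =
      (if q + 1 dvd n * t + 3 * j then 1 else 0 :: 'a)" for j
  proof -
    have "0 < n * s + 3 * (q - 1) * j"
      using s \<open>n > 0\<close> by simp
    then show ?thesis
      by (simp only: sum_powers_field dvd uminus_CHAR_2[OF assms(1), of 1])
  qed
  have expand: "(x ^ n * (x ^ (3 * (q - 1)) + a)) ^ s =
      (\<Sum>j\<in>J. a ^ s * inverse a ^ j * x ^ (n * s + 3 * (q - 1) * j))" for x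
  proof -
    define v where "v = x ^ (3 * (q - 1)) * inverse a"
    have "x ^ (3 * (q - 1)) + a = a * (1 + v)"
      using \<open>a \<noteq> 0\<close> by (simp add: v_def algebra_simps)
    then have "(x ^ n * (x ^ (3 * (q - 1)) + a)) ^ s = x ^ (n * s) * a ^ s * (1 + v) ^ s"
      by (simp add: power_mult_distrib power_mult)
    moreover have "(1 + v) ^ s = (\<Sum>j\<in>J. v ^ j)"
      using J(2) by (simp add: s_def)
    moreover have "v ^ j = inverse a ^ j * x ^ (3 * (q - 1) * j)" for j
      by (simp add: v_def power_mult_distrib power_mult)
    ultimately show ?thesis
      by (simp only: sum_distrib_left power_add mult_ac)
  qed
  have "(\<Sum>x\<in>UNIV. (x ^ n * (x ^ (3 * (q - 1)) + a)) ^ s) =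
      (\<Sum>j\<in>J. a ^ s * inverse a ^ j * (\<Sum>x\<in>UNIV. x ^ (n * s + 3 * (q - 1) * j)))"
    unfolding expand by (subst sum.swap) (simp add: sum_distrib_left)
  also have "\<dots> = (\<Sum>j\<in>J. if q + 1 dvd n * t + 3 * j then a ^ s * inverse a ^ j else 0)"
    unfolding power_sum by (intro sum.cong refl) simp
  also have "\<dots> = a ^ s * (\<Sum>j | j \<in> J \<and> q + 1 dvd n * t + 3 * j. inverse a ^ j)"
    unfolding sum_distrib_left by (rule sum.inter_filter[OF J(1), symmetric])
  finally show ?thesis
    by (simp add: s_def)
qed

section \<open>The case \<open>q mod 3 = 1\<close>: a single surviving term\<close>

lemma unique_residue_solution:
  fixes n q :: nat
  assumes "q mod 3 = 1" "\<not> 3 dvd n" "n < q"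
  obtains i where "{j. j < q \<and> q + 1 dvd n + 3 * j} = {i}"
proof -
  define r where "r = q div 3"
  have q: "q = 3 * r + 1"
    using assms(1) by (simp add: r_def) presburger
  \<comment> \<open>Modulo 3, \<open>n + 3 * j = k * (q + 1)\<close> reads \<open>n = 2 * k\<close>,
    which fixes the residue of \<open>k\<close>. Since \<open>n + 3 * j < 4 * (q + 1)\<close>, only
    one \<open>k\<close> in that residue class is possible.\<close>
  define k :: nat where "k = (if n mod 3 = 1 then 2 else 1)"
  define i where "i = (k * (q + 1) - n) div 3"
  have n: "n mod 3 = 1 \<or> n mod 3 = 2"
    using assms(2) by presburger
  have i: "n + 3 * i = k * (q + 1)"
    using n assms(3) unfolding i_def k_def q by (auto split: if_splits) presburger+
  have uniq: "k' = k" if eq: "n + 3 * j = (q + 1) * k'" and "j < q" for j k'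
  proof -
    have "(q + 1) * k' < (q + 1) * 4"
      using assms(3) \<open>j < q\<close> unfolding eq[symmetric] by simp
    then have "k' < 4"
      by (simp only: mult_less_cancel1)
    then have "k' \<in> {0, 1, 2, 3}"
      by auto
    then show ?thesis
      using eq assms(2,3) n unfolding q k_def by (auto split: if_splits) presburger+
  qed
  have "{j. j < q \<and> q + 1 dvd n + 3 * j} = {i}"
  proof (intro set_eqI iffI)
    fix j
    assume "j \<in> {j. j < q \<and> q + 1 dvd n + 3 * j}"
    then obtain k' where "j < q" "n + 3 * j = (q + 1) * k'"
      by (auto elim: dvdE)
    with uniq have "n + 3 * j = k * (q + 1)"
      by (metis mult.commute)
    with i show "j \<in> {i}"
      by simp
  next
    fix j
    assume "j \<in> {i}"
    moreover have "i < q"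
      using i assms(2,3) unfolding k_def by (auto split: if_splits)
    moreover have "q + 1 dvd n + 3 * i"
      unfolding i by (rule dvd_triv_right)
    ultimately show "j \<in> {j. j < q \<and> q + 1 dvd n + 3 * j}"
      by simp
  qed
  with that show ?thesis
    by blast
qed

text \<open>Here \<open>m\<close> is even. At \<open>s = q - 1\<close> all coefficients of
  \<open>(1 + v) ^ s\<close> are 1, and the power sum is a single power of \<open>a\<close> up to
  inversion, hence nonzero.\<close>

lemma not_bij_binomial_even_exponent:
  fixes a :: "'a::{finite,field}"
  assumes "CHAR('a) = 2" "CARD('a) = q\<^sup>2" "q = 2 ^ m" "q mod 3 = 1" "1 < q"
    and "\<not> 3 dvd n" "n < q" "a \<noteq> 0"
  shows "\<not> bij (\<lambda>x. x ^ n * (x ^ (3 * (q - 1)) + a))"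
proof
  assume bij: "bij (\<lambda>x. x ^ n * (x ^ (3 * (q - 1)) + a))"
  obtain i where i: "{j. j < q \<and> q + 1 dvd n + 3 * j} = {i}"
    using unique_residue_solution[OF assms(4,6,7)] by blast
  have "q * 1 < q * q"
    using assms(5) by (intro mult_strict_left_mono) auto
  then have "q - 1 < CARD('a) - 1"
    using assms(5) unfolding assms(2) power2_eq_square by linarith
  then have "(\<Sum>x\<in>UNIV. (x ^ n * (x ^ (3 * (q - 1)) + a)) ^ ((q - 1) * 1)) = 0"
    using sum_powers_of_bij[OF bij, of "q - 1"] assms(5) by simp
  moreover have "(\<Sum>x\<in>UNIV. (x ^ n * (x ^ (3 * (q - 1)) + a)) ^ ((q - 1) * 1)) =
      a ^ ((q - 1) * 1) * (\<Sum>j | j \<in> {..<q} \<and> q + 1 dvd n * 1 + 3 * j. inverse a ^ j)"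
    using assms one_plus_power_mersenne[OF assms(1), of _ m]
    by (intro sum_binomial_powers) (auto intro: Nat.gr0I)
  ultimately show False
    using i \<open>a \<noteq> 0\<close> by simp
qed

section \<open>The case \<open>q mod 3 = 2\<close>: the surviving exponents\<close>

lemma multiple_of_third_iff:
  fixes N K q j :: nat
  assumes "3 * N = q + 1" "2 \<le> K" "K \<le> N"
  shows "j < q \<and> N dvd K + j \<longleftrightarrow> (\<exists>i\<in>{1, 2, 3}. K + j = 0 + i * N)"
proof
  assume "j < q \<and> N dvd K + j"
  then obtain k where k: "j < q" "K + j = N * k"
    by (auto elim: dvdE)
  have "N * k < N * 4"
    using k assms by linarith
  then have "k \<in> {0, 1, 2, 3}"
    by auto
  then show "\<exists>i\<in>{1, 2, 3}. K + j = 0 + i * N"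
    using k assms by auto
next
  assume "\<exists>i\<in>{1, 2, 3}. K + j = 0 + i * N"
  then obtain i where i: "i \<in> {1, 2, 3}" "K + j = i * N"
    by (metis add_0)
  \<comment> \<open>The critical case is \<open>i = 3\<close>, where \<open>j = q + 1 - K\<close>
    lies below \<open>q\<close> only because \<open>2 \<le> K\<close>.\<close>
  then have "j < q"
    using assms by auto
  with i(2) show "j < q \<and> N dvd K + j"
    by simp
qed

text \<open>Modulo \<open>N\<close> one has \<open>q = -1\<close>, so the shift by
  \<open>q * P\<close> turns the condition into \<open>K + j = P\<close>. The sign of
  \<open>P - K\<close> decides which three multiples of \<open>N\<close> keep \<open>j\<close>
  between 0 and \<open>q - 1\<close>.\<close>

lemma shifted_multiple_of_third_iff:
  fixes N K P q j :: nat
  assumes "3 * N = q + 1" "0 < K" "K \<le> N" "P < N" "K \<le> P \<or> P + 2 \<le> K"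
  shows "j < q \<and> N dvd K + (q * P + j) \<longleftrightarrow>
    (\<exists>i\<in>(if K \<le> P then {0, 1, 2} else {1, 2, 3}). K + j = P + i * N)"
proof
  assume "j < q \<and> N dvd K + (q * P + j)"
  then obtain k where k: "j < q" "K + (q * P + j) = N * k"
    by (auto elim: dvdE)
  have "q * P + P = N * (3 * P)"
    using assms(1) by (metis add.commute mult.assoc mult.commute mult_Suc Suc_eq_plus1)
  with k have eq: "N * k + P = N * (3 * P) + (K + j)"
    by linarith
  have "N * (3 * P) < N * (k + 1)"
    using eq \<open>P < N\<close> by (simp add: algebra_simps)
  then have "3 * P \<le> k"
    by (simp only: mult_less_cancel1) linarith
  then obtain i where "k = 3 * P + i"
    using le_Suc_ex by blast
  with eq have i: "K + j = P + N * i"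
    by (simp add: algebra_simps)
  then have "N * i < N * 4"
    using k(1) assms by linarith
  then have "i \<in> {0, 1, 2, 3}"
    by auto
  then show "\<exists>i\<in>(if K \<le> P then {0, 1, 2} else {1, 2, 3}). K + j = P + i * N"
    using i k(1) assms by auto
next
  assume "\<exists>i\<in>(if K \<le> P then {0, 1, 2} else {1, 2, 3}). K + j = P + i * N"
  then obtain i where i: "i \<in> (if K \<le> P then {0, 1, 2} else {1, 2, 3})" "K + j = P + i * N"
    by blast
  have "K + (q * P + j) = (q + 1) * P + i * N"
    using i(2) by simp
  also have "\<dots> = N * (3 * P + i)"
    unfolding assms(1)[symmetric] by (simp add: algebra_simps)
  finally have "N dvd K + (q * P + j)"
    by simp
  moreover have "j < q"
    using i assms by (auto split: if_splits)
  ultimately show "j < q \<and> N dvd K + (q * P + j)"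
    by blast
qed

text \<open>Exponents in a progression of step \<open>N\<close> leave a polynomial in
  \<open>b ^ N\<close>, whose coefficients 0 and 1 record the condition \<open>S\<close>.\<close>

lemma sum_powers_progression:
  fixes b :: "'a::comm_semiring_1" and N :: nat
  assumes "finite I" "0 < N" "\<And>i. i \<in> I \<Longrightarrow> K \<le> c + i * N"
  shows "(\<Sum>j | S j \<and> (\<exists>i\<in>I. K + j = c + i * N). b ^ (K + j)) =
    b ^ c * (\<Sum>i\<in>I. of_bool (S (c + i * N - K)) * (b ^ N) ^ i)"
proof -
  have "(\<Sum>j | S j \<and> (\<exists>i\<in>I. K + j = c + i * N). b ^ (K + j)) =
      (\<Sum>i | i \<in> I \<and> S (c + i * N - K). b ^ (c + i * N))"
  proof (rule sum.reindex_bij_witness[of _ "\<lambda>i. c + i * N - K" "\<lambda>j. (K + j - c) div N"])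
    fix j
    assume "j \<in> {j. S j \<and> (\<exists>i\<in>I. K + j = c + i * N)}"
    then obtain i where i: "S j" "i \<in> I" "K + j = c + i * N"
      by blast
    then have "j = c + i * N - K" "(K + j - c) div N = i"
      using assms(2) by simp_all
    with i show "c + (K + j - c) div N * N - K = j"
      and "(K + j - c) div N \<in> {i. i \<in> I \<and> S (c + i * N - K)}"
      and "b ^ (c + (K + j - c) div N * N) = b ^ (K + j)"
      by auto
  next
    fix i
    assume "i \<in> {i. i \<in> I \<and> S (c + i * N - K)}"
    then show "(K + (c + i * N - K) - c) div N = i"
      and "c + i * N - K \<in> {j. S j \<and> (\<exists>i\<in>I. K + j = c + i * N)}"
      using assms by auto
  qed
  also have "\<dots> = (\<Sum>i\<in>I. if S (c + i * N - K) then b ^ (c + i * N) else 0)"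
    using assms(1) by (rule sum.inter_filter)
  also have "\<dots> = b ^ c * (\<Sum>i\<in>I. of_bool (S (c + i * N - K)) * (b ^ N) ^ i)"
    unfolding sum_distrib_left
    by (rule sum.cong) (simp_all add: power_add power_mult mult.commute flip: power_mult)
  finally show ?thesis .
qed

section \<open>Binary digits of the surviving exponents, and the identity they enter\<close>

lemma div_third_progression:
  fixes N T P R i n :: int
  assumes "3 * N = P * R + 1" "3 * T = P + 1" "0 \<le> n" "n \<le> P" "0 < i" "i < P"
  shows "(i * N - n * T) div P = (i * R - n - of_bool (i < n)) div 3"
proof -
  define k where "k = (i * R - n - of_bool (i < n)) div 3"
  have k: "3 * k \<le> i * R - n - of_bool (i < n)" "i * R - n - of_bool (i < n) \<le> 3 * k + 2"
    unfolding k_def by simp_all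
  \<comment> \<open>The term \<open>i - n\<close> lies strictly between \<open>-P\<close> and
    \<open>P\<close>, so after division by \<open>P\<close> it lowers the floor by one exactly when
    it is negative. What remains depends on \<open>P\<close> only through \<open>R\<close>.\<close>
  have eq: "3 * (i * N - n * T) = P * (i * R - n) + (i - n)"
  proof -
    have "3 * (i * N - n * T) = i * (3 * N) - n * (3 * T)"
      by (simp add: algebra_simps)
    then show ?thesis
      unfolding assms by (simp add: algebra_simps)
  qed
  have "3 * (P * k) \<le> 3 * (i * N - n * T) \<and> 3 * (i * N - n * T) < 3 * (P * k + P)"
  proof (cases "i < n")
    case True
    have "P * (3 * k) \<le> P * (i * R - n - 1)" "P * (i * R - n) \<le> P * (3 * k + 3)"
      using True k assms by (intro mult_left_mono; simp)+
    then show ?thesis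
      unfolding eq using True assms by (simp add: algebra_simps)
  next
    case False
    have "P * (3 * k) \<le> P * (i * R - n)" "P * (i * R - n) \<le> P * (3 * k + 2)"
      using False k assms by (intro mult_left_mono; simp)+
    then show ?thesis
      unfolding eq using False assms by (simp add: algebra_simps)
  qed
  then have "P * k \<le> i * N - n * T" "i * N - n * T < P * k + P"
    by (simp_all only: mult_le_cancel_left_pos mult_less_cancel_left_pos zero_less_numeral)
  then show ?thesis
    unfolding k_def[symmetric]
    by (intro int_div_pos_eq[where r = "i * N - n * T - P * k"]) auto
qed

lemma odd_div_third_progression:
  fixes N T P R i n :: nat
  assumes "3 * N = P * R + 1" "3 * T = P + 1" "n \<le> P" "0 < i" "i < P" "n * T \<le> N"
  shows "odd ((i * N - n * T) div P) \<longleftrightarrow>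
    odd ((int i * int R - int n - of_bool (i < n)) div 3)"
proof -
  have "n * T \<le> i * N"
    using assms(4,6) by (metis le_trans mult_le_mono1 nat_mult_1 Suc_leI One_nat_def)
  then have "int ((i * N - n * T) div P) = (int i * int N - int n * int T) div int P"
    by (simp add: zdiv_int of_nat_diff)
  also have "\<dots> = (int i * int R - int n - of_bool (int i < int n)) div 3"
  proof (rule div_third_progression)
    show "3 * int N = int P * int R + 1" "3 * int T = int P + 1"
      using assms(1,2) by (metis of_nat_1 of_nat_add of_nat_mult of_nat_numeral)+
  qed (use assms in auto)
  finally have "even (int ((i * N - n * T) div P)) \<longleftrightarrow>
      even ((int i * int R - int n - of_bool (i < n)) div 3)"
    by simp
  then show ?thesis
    by (simp only: even_of_nat)
qed

text \<open>Hermite's criterion at \<open>s = (q - 1) * (P + 1)\<close> gives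
  \<open>U + B ^ (3 * P) * V = 0\<close>, where \<open>U\<close> comes from the exponents below
  \<open>q\<close> and \<open>V\<close> from those shifted by \<open>q * P\<close>. The digit
  conditions in \<open>U\<close> and \<open>V\<close> are complementary, so \<open>U + V\<close>,
  the right-hand side, is free of digits.\<close>

lemma bij_binomial_power_identity:
  fixes a :: "'a::{finite,field}"
  assumes char: "CHAR('a) = 2" and card: "CARD('a) = q\<^sup>2"
    and q: "q = 2 ^ m" and P: "P = 2 ^ e" and qR: "q = P * R" and R: "even R" "4 \<le> R"
    and N: "3 * N = q + 1" and T: "3 * T = P + 1"
    and n: "0 < n" "n \<noteq> 3" "n \<le> P" "n * T \<le> N" and P8: "8 \<le> P" and "a \<noteq> 0"
    and bij: "bij (\<lambda>x. x ^ n * (x ^ (3 * (q - 1)) + a))"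
    and B: "B = inverse a ^ N"
  shows "(1 + B ^ (3 * P)) *
      (if n < 3 then 1 + of_bool (odd ((1 * N - n * T) div P)) * B
         + of_bool (odd ((2 * N - n * T) div P)) * B ^ 2
       else \<Sum>i\<in>{1, 2, 3}. of_bool (odd ((i * N - n * T) div P)) * B ^ i) =
      (if n < 3 then 1 + B + B ^ 2 else B + B ^ 2 + B ^ 3)"
proof -
  define K where "K = n * T"
  define b where "b = inverse a"
  define J where "J = {j. j < q \<and> even (j div P)}"
  have "4 * P \<le> q"
    using R(2) by (simp add: qR)
  then have PN: "P + 1 < N" "P < q" "1 < q" "0 < N"
    using N P8 by linarith+
  have "T \<le> n * T"
    using n(1) by simp
  then have K2: "2 \<le> K" "K \<le> N"
    using T P8 n(4) unfolding K_def by linarith+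
  have K3: "3 * K = n * (P + 1)"
    unfolding K_def T[symmetric] by simp
  \<comment> \<open>As \<open>3 * K = n * (P + 1)\<close>, excluding \<open>n = 3\<close> keeps
    \<open>K\<close> away from \<open>P + 1\<close>; the two sides need different index ranges in
    \<open>V\<close>.\<close>
  have K_small: "K \<le> P" if "n < 3"
  proof -
    have "3 * K \<le> 2 * (P + 1)"
      unfolding K3 using that by (intro mult_right_mono) auto
    then show ?thesis
      using P8 by simp
  qed
  have K_large: "P + 2 \<le> K" if "\<not> n < 3"
  proof -
    have "4 * (P + 1) \<le> 3 * K"
      unfolding K3 using that n(2) by (intro mult_right_mono) auto
    then show ?thesis
      using P8 by simp
  qed
  have K_iff: "K \<le> P \<longleftrightarrow> n < 3"
    using K_small K_large by fastforce
  have x2: "x + x = 0" for x :: 'a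
    using char uminus_CHAR_2[of x] by (metis add.right_inverse)
  have finJ: "finite J"
    by (simp add: J_def)
  define J' where "J' = J \<union> (\<lambda>j. q * P + j) ` J"
  have "\<not> q * P + j < q" for j
    using P8 by (simp add: not_less trans_le_add1)
  then have disj: "J \<inter> (\<lambda>j. q * P + j) ` J = {}"
    by (auto simp: J_def)
  have sumJ: "(1 + v) ^ ((q - 1) * (P + 1)) = (\<Sum>j\<in>J'. v ^ j)" for v :: 'a
  proof -
    have "e < m"
      using \<open>P < q\<close> by (simp add: q P)
    then obtain d where d: "m = e + 1 + d"
      by (metis Suc_eq_plus1 less_imp_Suc_add add_Suc add.commute)
    \<comment> \<open>The first summand is the power of two \<open>2 ^ (m + e)\<close>, handled by
      Frobenius; the second has every binary digit 1 except digit \<open>e\<close>.\<close>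
    have "(q - 1) * (P + 1) = q * P + (q - 1 - P)"
      using \<open>P < q\<close> by (simp add: algebra_simps diff_mult_distrib)
    then have "(1 + v) ^ ((q - 1) * (P + 1)) = (1 + v) ^ (q * P) * (1 + v) ^ (q - 1 - P)"
      by (simp add: power_add)
    also have "(1 + v) ^ (q * P) = 1 + v ^ (q * P)"
      using one_plus_power_two_power[OF char, of v "m + e"] by (simp add: q P power_add)
    also have "(1 + v) ^ (q - 1 - P) = (\<Sum>j\<in>J. v ^ j)"
      using one_plus_power_mersenne_minus_bit[OF char, of v e d] by (simp add: q P J_def d)
    also have "(1 + v ^ (q * P)) * (\<Sum>j\<in>J. v ^ j) =
        (\<Sum>j\<in>J. v ^ j) + (\<Sum>j\<in>(\<lambda>j. q * P + j) ` J. v ^ j)"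
      by (subst sum.reindex) (simp_all add: power_add distrib_right flip: sum_distrib_left)
    also have "\<dots> = (\<Sum>j\<in>J'. v ^ j)"
      using finJ disj by (simp add: J'_def sum.union_disjoint)
    finally show ?thesis .
  qed
  have dvd: "q + 1 dvd n * (P + 1) + 3 * j \<longleftrightarrow> N dvd K + j" for j
  proof -
    have "n * (P + 1) + 3 * j = 3 * (K + j)"
      using K3 by simp
    then show ?thesis
      unfolding N[symmetric] by (simp only: nat_mult_dvd_cancel_disj) auto
  qed
  have "(q - 1) * (P + 1) < (q - 1) * (q + 1)"
    using \<open>P < q\<close> \<open>1 < q\<close> by (intro mult_strict_left_mono) auto
  also have "\<dots> = CARD('a) - 1"
    using card by (simp add: power2_eq_square algebra_simps diff_mult_distrib)
  finally have "(\<Sum>x\<in>UNIV. (x ^ n * (x ^ (3 * (q - 1)) + a)) ^ ((q - 1) * (P + 1))) = 0"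
    using \<open>1 < q\<close> by (intro sum_powers_of_bij[OF bij]) auto
  moreover have "(\<Sum>x\<in>UNIV. (x ^ n * (x ^ (3 * (q - 1)) + a)) ^ ((q - 1) * (P + 1))) =
      a ^ ((q - 1) * (P + 1)) * (\<Sum>j | j \<in> J' \<and> q + 1 dvd n * (P + 1) + 3 * j. inverse a ^ j)"
    using \<open>1 < q\<close> n finJ \<open>a \<noteq> 0\<close> sumJ
    by (intro sum_binomial_powers[OF char card]) (auto simp: J'_def)
  ultimately have "(\<Sum>j | j \<in> J' \<and> N dvd K + j. b ^ j) = 0"
    using \<open>a \<noteq> 0\<close> unfolding dvd b_def by simp
  moreover have "{j. j \<in> J' \<and> N dvd K + j} =
      {j. j \<in> J \<and> N dvd K + j} \<union> (\<lambda>j. q * P + j) ` {j. j \<in> J \<and> N dvd K + (q * P + j)}"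
    by (auto simp: J'_def)
  moreover have "(\<Sum>j\<in>{j. j \<in> J \<and> N dvd K + j} \<union>
        (\<lambda>j. q * P + j) ` {j. j \<in> J \<and> N dvd K + (q * P + j)}. b ^ j) =
      (\<Sum>j | j \<in> J \<and> N dvd K + j. b ^ j) +
      b ^ (q * P) * (\<Sum>j | j \<in> J \<and> N dvd K + (q * P + j). b ^ j)"
    using finJ disj
    by (subst sum.union_disjoint; (subst sum.reindex)?) (auto simp: power_add sum_distrib_left)
  \<comment> \<open>The factor \<open>b ^ K\<close> completes the exponents to \<open>K + j\<close>,
    which run through progressions of step \<open>N\<close>.\<close>
  ultimately have "b ^ K * ((\<Sum>j | j \<in> J \<and> N dvd K + j. b ^ j) +
      b ^ (q * P) * (\<Sum>j | j \<in> J \<and> N dvd K + (q * P + j). b ^ j)) = 0"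
    by simp
  then have zero: "(\<Sum>j | j \<in> J \<and> N dvd K + j. b ^ (K + j)) +
      b ^ (q * P) * (\<Sum>j | j \<in> J \<and> N dvd K + (q * P + j). b ^ (K + j)) = 0"
    by (simp add: power_add sum_distrib_left algebra_simps)

  define U where "U = (\<Sum>i\<in>{1, 2, 3}. of_bool (even ((i * N - K) div P)) * B ^ i)"
  define I :: "nat set" where "I = (if K \<le> P then {0, 1, 2} else {1, 2, 3})"
  define V where "V = (\<Sum>i\<in>I. of_bool (even ((P + i * N - K) div P)) * B ^ i)"
  have "{j. j \<in> J \<and> N dvd K + j} =
      {j. even (j div P) \<and> (\<exists>i\<in>{1, 2, 3}. K + j = 0 + i * N)}"
    using multiple_of_third_iff[OF N K2] by (auto simp: J_def)
  moreover have "K \<le> 0 + i * N" if "i \<in> {1, 2, 3}" for i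
    using that K2 by auto
  ultimately have U: "(\<Sum>j | j \<in> J \<and> N dvd K + j. b ^ (K + j)) = U"
    using sum_powers_progression[of "{1, 2, 3}" N K 0 b "\<lambda>j. even (j div P)"] PN
    by (simp add: U_def B b_def)
  have "j < q \<and> N dvd K + (q * P + j) \<longleftrightarrow> (\<exists>i\<in>I. K + j = P + i * N)" for j
    unfolding I_def
    by (rule shifted_multiple_of_third_iff[OF N]) (use K2 PN K_large K_iff in auto)
  then have "{j. j \<in> J \<and> N dvd K + (q * P + j)} =
      {j. even (j div P) \<and> (\<exists>i\<in>I. K + j = P + i * N)}"
    unfolding J_def by blast
  moreover have "K \<le> P + i * N" if "i \<in> I" for i
    using that K2 by (auto simp: I_def split: if_splits)
  moreover have "finite I"
    by (simp add: I_def)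
  ultimately have V: "(\<Sum>j | j \<in> J \<and> N dvd K + (q * P + j). b ^ (K + j)) = b ^ P * V"
    using sum_powers_progression[of I N K P b "\<lambda>j. even (j div P)"] PN
    by (simp add: V_def B b_def)
  have "U + b ^ (q * P) * (b ^ P * V) = 0"
    using zero U V by simp
  moreover have "b ^ (q * P) * b ^ P = B ^ (3 * P)"
  proof -
    have "q * P + P = N * (3 * P)"
      using N by (metis add.commute mult.assoc mult.commute mult_Suc Suc_eq_plus1)
    then show ?thesis
      by (simp add: B b_def flip: power_add power_mult)
  qed
  ultimately have UV: "U + B ^ (3 * P) * V = 0"
    by (metis mult.assoc)
  \<comment> \<open>Adding \<open>P = 2 ^ e\<close> flips binary digit \<open>e\<close>.\<close>
  have shift: "even ((P + i * N - K) div P) \<longleftrightarrow> odd ((i * N - K) div P)" if "0 < i" for i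
  proof -
    have "K \<le> i * N"
      using that K2 by (cases i) auto
    then have "P + i * N - K = (i * N - K) + P"
      by simp
    moreover have "((i * N - K) + P) div P = (i * N - K) div P + 1"
      using P8 by (intro div_add_self2) simp
    ultimately show ?thesis
      by (simp only: even_plus_one_iff)
  qed
  have V_eq: "V = (if n < 3 then 1 + of_bool (odd ((1 * N - K) div P)) * B
         + of_bool (odd ((2 * N - K) div P)) * B ^ 2
       else \<Sum>i\<in>{1, 2, 3}. of_bool (odd ((i * N - K) div P)) * B ^ i)"
  proof (cases "n < 3")
    case True
    then have "(P - K) div P = 0"
      using K2 P8 by simp
    then show ?thesis
      using True K_iff shift[of 1] shift[of 2]
      by (simp add: V_def I_def del: sum_of_bool_mult_eq)
  next
    case False
    then show ?thesis
      using K_iff shift by (auto simp: V_def I_def intro!: sum.cong)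
  qed
  have "U + V = (if n < 3 then 1 + B + B ^ 2 else B + B ^ 2 + B ^ 3)"
  proof (cases "n < 3")
    case True
    \<comment> \<open>The index 3 occurs in \<open>U\<close> but not in \<open>V\<close>. Its
      quotient is \<open>R - 1\<close>, which is odd, so the coefficient of \<open>B ^ 3\<close> in
      \<open>U\<close> is zero.\<close>
    then have "(int 3 * int R - int n - of_bool (3 < n)) div 3 = int R - 1"
      using n(1) by simp
    then have "odd ((3 * N - K) div P)"
      using odd_div_third_progression[of N P R T n 3] N T n P8 R(1) by (simp add: K_def qR)
    then show ?thesis
      using True unfolding V_eq U_def by (simp del: sum_of_bool_mult_eq)
  next
    case False
    then show ?thesis
      unfolding V_eq U_def by (simp del: sum_of_bool_mult_eq)
  qed
  moreover have "B ^ (3 * P) * V = U"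
    using UV x2[of U] by (metis add_left_cancel)
  then have "(1 + B ^ (3 * P)) * V = U + V"
    by (simp only: distrib_right mult_1_left add.commute)
  ultimately show ?thesis
    unfolding V_eq K_def by simp
qed

text \<open>Here \<open>m\<close> is odd. The fourth-power bound leaves room for two digit positions
  \<open>e\<close> and \<open>e + 2\<close>, whose identities are compared.\<close>

lemma not_bij_binomial_odd_exponent:
  fixes a :: "'a::{finite,field}"
  assumes char: "CHAR('a) = 2" and card: "CARD('a) = q\<^sup>2"
    and q: "q = 2 ^ m" "q mod 3 = 2" and n: "0 < n" "\<not> 3 dvd n"
    and D: "n \<le> D" "3 \<le> D" "(2 * D) ^ 4 \<le> q"
    and "a \<noteq> 0" "a ^ (q + 1) \<noteq> 1"
  shows "\<not> bij (\<lambda>x. x ^ n * (x ^ (3 * (q - 1)) + a))"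
proof
  assume bij: "bij (\<lambda>x. x ^ n * (x ^ (3 * (q - 1)) + a))"
  obtain k where k: "4 ^ k \<le> D" "D < 4 ^ (k + 1)"
    using ex_power_ivl1[of 4 D] D(2) by auto
  \<comment> \<open>An odd \<open>e\<close> gives \<open>P mod 3 = 2\<close>, and the choice of
    \<open>k\<close> gives \<open>2 * D < P \<le> 8 * D\<close>: at least \<open>n\<close>, yet
    small against \<open>q\<close>.\<close>
  define e where "e = 2 * k + 3"
  define P :: nat where "P = 2 ^ e"
  have P4: "P = 8 * 4 ^ k"
    by (simp add: P_def e_def power_add power_mult)
  have P: "8 \<le> P" "n \<le> P" "P \<le> 8 * D"
    using k D(1) by (simp_all add: P4)
  have "(4 :: nat) ^ k mod 3 = 1"
    by (simp add: power_mod[of 4 3 k, symmetric])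
  then have P3: "P mod 3 = 2"
    unfolding P4 by presburger
  have D2: "9 \<le> D * D"
    using mult_mono[of 3 D 3 D] D(2) by simp
  have Dq: "16 * (D * D) * (D * D) \<le> q"
    using D(3) by (simp add: power4_eq_xxxx)
  \<comment> \<open>This makes the cofactor \<open>R = q / (4 * P)\<close> an even number that is at
    least 4.\<close>
  have "128 * D \<le> 16 * D * (D * D)"
    using mult_left_mono[of 8 "D * D" "16 * D"] D2 by simp
  also have "\<dots> \<le> 16 * D * (D * D) * D"
    using D(2) by simp
  also have "\<dots> \<le> q"
    using Dq by (simp add: mult_ac)
  finally have Pq: "16 * P \<le> q"
    using P(3) by linarith
  then have "(2 :: nat) ^ (e + 4) \<le> 2 ^ m"
    by (simp add: P_def q(1) power_add)
  then have em: "e + 4 \<le> m"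
    by (simp only: power_increasing_iff)
  define R :: nat where "R = 2 ^ (m - e - 2)"
  have qR: "q = 4 * P * R"
  proof -
    have "2 + e + (m - e - 2) = m"
      using em by simp
    then have "q = 2 ^ 2 * 2 ^ e * 2 ^ (m - e - 2)"
      unfolding q(1) by (simp only: power_add[symmetric])
    then show ?thesis
      by (simp add: R_def P_def)
  qed
  have R4: "4 \<le> R"
    using Pq P(1) unfolding qR by (simp add: mult.commute)
  have R_even: "even R"
    using em by (simp add: R_def)
  define N where "N = (q + 1) div 3"
  define T where "T = (P + 1) div 3"
  define T' where "T' = (4 * P + 1) div 3"
  have N: "3 * N = q + 1"
    using q(2) unfolding N_def by presburger
  have T: "3 * T = P + 1" and T': "3 * T' = 4 * P + 1"
    using P3 unfolding T_def T'_def by presburger+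
  have "3 * (n * T') = n * (4 * P + 1)"
    unfolding T'[symmetric] by simp
  also have "\<dots> \<le> D * (32 * D + 1)"
    using D(1) P(3) by (intro mult_mono) auto
  also have "\<dots> \<le> 33 * (D * D)"
    using D(2) by (simp add: algebra_simps)
  also have "\<dots> \<le> 16 * (D * D) * (D * D)"
    using D2 by simp
  also have "\<dots> \<le> 3 * N"
    using Dq N by simp
  finally have nT': "n * T' \<le> N"
    by simp
  have "n * T \<le> n * T'"
    using T T' by (intro mult_left_mono) linarith+
  also note nT'
  finally have nT: "n * T \<le> N" .
  define B where "B = inverse a ^ N"
  define V where "V = (if n < 3 then 1 + of_bool (odd ((1 * N - n * T) div P)) * B
         + of_bool (odd ((2 * N - n * T) div P)) * B ^ 2
       else \<Sum>i\<in>{1, 2, 3}. of_bool (odd ((i * N - n * T) div P)) * B ^ i)"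
  define W where "W = (if n < 3 then 1 + B + B ^ 2 else B + B ^ 2 + B ^ 3)"
  \<comment> \<open>Passing from \<open>R\<close> to \<open>4 * R\<close> adds
    \<open>3 * i * R\<close> to the numerator, hence the even number \<open>i * R\<close> to the
    quotient.\<close>
  have parity: "odd ((i * N - n * T') div (4 * P)) \<longleftrightarrow> odd ((i * N - n * T) div P)"
    if "i \<in> {1, 2, 3}" for i
  proof -
    have "odd ((i * N - n * T) div P) \<longleftrightarrow>
        odd ((int i * int (4 * R) - int n - of_bool (i < n)) div 3)"
      by (rule odd_div_third_progression) (use N T P nT that qR in auto)
    moreover have "odd ((i * N - n * T') div (4 * P)) \<longleftrightarrow>
        odd ((int i * int R - int n - of_bool (i < n)) div 3)"
      by (rule odd_div_third_progression) (use N T' P nT' that qR in auto)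
    moreover have "int i * int (4 * R) - int n - of_bool (i < n) =
        (int i * int R - int n - of_bool (i < n)) + (int i * int R) * 3"
      by simp
    then have "(int i * int (4 * R) - int n - of_bool (i < n)) div 3 =
        int i * int R + (int i * int R - int n - of_bool (i < n)) div 3"
      by (simp only: div_mult_self3)
    ultimately show ?thesis
      using R_even by simp
  qed
  have "n \<noteq> 3"
    using n(2) by auto
  have "(1 + B ^ (3 * P)) * V = W"
    unfolding V_def W_def
    by (rule bij_binomial_power_identity[OF char card q(1) P_def, where R = "4 * R"])
      (use qR R4 N T n \<open>n \<noteq> 3\<close> P nT \<open>a \<noteq> 0\<close> bij B_def in auto)
  moreover have "(1 + B ^ (3 * (4 * P))) * V = W"
  proof -
    have P4': "4 * P = 2 ^ (e + 2)"
      by (simp add: P_def)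
    have "(1 + B ^ (3 * (4 * P))) *
        (if n < 3 then 1 + of_bool (odd ((1 * N - n * T') div (4 * P))) * B
           + of_bool (odd ((2 * N - n * T') div (4 * P))) * B ^ 2
         else \<Sum>i\<in>{1, 2, 3}. of_bool (odd ((i * N - n * T') div (4 * P))) * B ^ i) = W"
      unfolding W_def
      by (rule bij_binomial_power_identity[OF char card q(1) P4', where R = R])
        (use qR R4 R_even N T' n \<open>n \<noteq> 3\<close> P nT' \<open>a \<noteq> 0\<close> bij B_def in auto)
    moreover have "odd ((1 * N - n * T') div (4 * P)) = odd ((1 * N - n * T) div P)"
      "odd ((2 * N - n * T') div (4 * P)) = odd ((2 * N - n * T) div P)"
      by (rule parity; simp)+
    moreover have "(\<Sum>i\<in>{1, 2, 3}. of_bool (odd ((i * N - n * T') div (4 * P))) * B ^ i) =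
        (\<Sum>i\<in>{1, 2, 3}. of_bool (odd ((i * N - n * T) div P)) * B ^ i)"
      by (rule sum.cong[OF refl]) (subst parity, simp_all only:)
    ultimately show ?thesis
      unfolding V_def by (simp only:)
  qed
  \<comment> \<open>If \<open>V = 0\<close>, then \<open>W = 0\<close>, so
    \<open>1 + B + B ^ 2 = 0\<close> and \<open>B ^ 3 = 1\<close>; but \<open>B ^ 3\<close> is the
    inverse of \<open>a ^ (q + 1)\<close>.\<close>
  moreover have "V \<noteq> 0"
  proof
    assume "V = 0"
    with calculation have "W = 0"
      by simp
    define h where "h = 1 + B + B ^ 2"
    have "B \<noteq> 0"
      using \<open>a \<noteq> 0\<close> by (simp add: B_def)
    moreover have "W = (if n < 3 then h else B * h)"
      by (simp add: W_def h_def algebra_simps power2_eq_square power3_eq_cube)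
    ultimately have "h = 0"
      using \<open>W = 0\<close> by (auto split: if_splits)
    moreover have "B ^ 3 - 1 = (B - 1) * h"
      by (simp add: h_def algebra_simps power2_eq_square power3_eq_cube)
    ultimately have "B ^ 3 = 1"
      by simp
    then have "inverse a ^ (q + 1) = 1"
      using N by (simp add: B_def mult.commute flip: power_mult)
    then show False
      using assms(11) by (simp only: power_inverse inverse_eq_1_iff)
  qed
  ultimately have "B ^ (3 * P) = B ^ (3 * (4 * P))"
    by (metis add_left_cancel mult_cancel_right)
  moreover define h where "h = inverse a ^ (q + 1)"
  have h: "B ^ (3 * k) = h ^ k" for k
  proof -
    have "B ^ (3 * k) = inverse a ^ (3 * N * k)"
      by (simp add: B_def mult_ac flip: power_mult)
    then show ?thesis
      unfolding N by (simp only: h_def power_mult)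
  qed
  ultimately have "h ^ P = h ^ (P + 3 * P)"
    by (simp only: h) simp
  then have "h ^ P * (h ^ 3) ^ P = h ^ P * 1"
    by (simp only: power_add power_mult mult_1_right)
  moreover have "h \<noteq> 0"
    using \<open>a \<noteq> 0\<close> by (simp add: h_def)
  ultimately have "(h ^ 3) ^ P = 1"
    by simp
  then have "(1 + h ^ 3) ^ P = 1 + 1"
    unfolding P_def using one_plus_power_two_power[OF char, of "h ^ 3" e] by simp
  also have "(1 :: 'a) + 1 = 0"
    using char uminus_CHAR_2[of "1 :: 'a"] by (metis add.right_inverse)
  finally have "1 + h ^ 3 = 0"
    by (simp only: power_eq_0_iff)
  then have h3: "h ^ 3 = 1"
    using \<open>(1 :: 'a) + 1 = 0\<close> by (metis add_left_cancel)
  \<comment> \<open>As the norm of \<open>inverse a\<close> to the subfield with \<open>q\<close>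
    elements, \<open>h\<close> satisfies \<open>h ^ (q - 1) = 1\<close>; since \<open>q - 1\<close>
    is 1 modulo 3, \<open>h ^ 3 = 1\<close> then forces \<open>h = 1\<close>.\<close>
  have "(q + 1) * (q - 1) = CARD('a) - 1"
    unfolding card power2_eq_square by (simp add: algebra_simps diff_mult_distrib2)
  then have "h ^ (q - 1) = inverse a ^ (CARD('a) - 1)"
    unfolding h_def by (simp only: power_mult[symmetric])
  also have "\<dots> = 1"
    using nonzero_power_card_minus_one[of "inverse a"] \<open>a \<noteq> 0\<close> by simp
  finally have "h ^ (q - 1) = 1" .
  moreover have "q - 1 = 3 * ((q - 1) div 3) + 1"
    using q(2) by presburger
  then have "h ^ (q - 1) = (h ^ 3) ^ ((q - 1) div 3) * h"
    by (metis power_add power_mult power_one_right)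
  ultimately have "h = 1"
    using h3 by simp
  then show False
    using assms(11) by (simp only: h_def power_inverse inverse_eq_1_iff)
qed

section \<open>Reduction to the two residues of \<open>q\<close> modulo 3\<close>

theorem theorem1p9:
  fixes q m n :: nat
    and a :: "'a::{finite,field}"
  assumes "m \<ge> 1"
    and "q = 2 ^ m"
    and "CARD('a) = q\<^sup>2"
    and "n \<ge> 1"
    and "a \<noteq> 0"
    and "int q \<ge> (2 * max (int n) (6 - int n)) ^ 4"
    and "a ^ (q + 1) \<noteq> 1"
  shows "\<not> permutation_binomial (monom 1 n * (monom 1 (3 * (q - 1)) + [:a:]))"
proof
  assume "permutation_binomial (monom 1 n * (monom 1 (3 * (q - 1)) + [:a:]))"
  then have "bij (poly (monom 1 n * (monom 1 (3 * (q - 1)) + [:a:])))"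
    by (simp add: permutation_binomial_def)
  also have "poly (monom 1 n * (monom 1 (3 * (q - 1)) + [:a:])) =
      (\<lambda>x. x ^ n * (x ^ (3 * (q - 1)) + a))"
    by (auto simp: poly_monom)
  finally have bij: "bij (\<lambda>x. x ^ n * (x ^ (3 * (q - 1)) + a))" .
  have "CHAR('a) dvd CARD('a)"
    using of_nat_card_field[where 'a = 'a] by (simp only: of_nat_eq_0_iff_char_dvd)
  then have "CHAR('a) dvd 2 ^ (m * 2)"
    by (simp only: assms(2,3) power_mult)
  moreover have prime: "prime CHAR('a)"
    by (rule prime_CHAR_semidom) (simp add: finite_imp_CHAR_pos)
  ultimately have "CHAR('a) dvd 2"
    using prime_dvd_power by blast
  with prime have char: "CHAR('a) = 2"
    using primes_dvd_imp_eq two_is_prime_nat by blast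
  \<comment> \<open>\<open>n\<close> and \<open>6 - n\<close> add up to 6, so their maximum is at
    least 3 and survives the conversion to \<open>nat\<close>.\<close>
  define D where "D = nat (max (int n) (6 - int n))"
  have D: "n \<le> D" "3 \<le> D"
    by (auto simp: D_def)
  have "int D = max (int n) (6 - int n)"
    by (auto simp: D_def)
  with assms(6) have "int ((2 * D) ^ 4) \<le> int q"
    by simp
  then have Dq: "(2 * D) ^ 4 \<le> q"
    by linarith
  have "2 * D \<le> (2 * D) ^ 4"
    by (rule self_le_power) (use D in auto)
  with Dq D have nq: "n < q" "1 < q"
    by linarith+
  have "\<not> 3 dvd q"
    unfolding assms(2) using prime_dvd_power[of 3 "2 :: nat" m] by auto
  then have q3: "q mod 3 = 1 \<or> q mod 3 = 2"
    by presburger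
  have "3 dvd CARD('a) - 1"
  proof -
    have "q * q mod 3 = 1"
      using q3 by (auto simp: mod_mult_eq[of q 3 q, symmetric])
    then show ?thesis
      unfolding assms(3) power2_eq_square by presburger
  qed
  then obtain x y :: 'a where xy: "x \<noteq> y" "x ^ 3 = y ^ 3"
    using cubing_not_inj by (auto simp: inj_def)
  \<comment> \<open>If \<open>3 dvd n\<close>, the map depends on \<open>x\<close> only through
    \<open>x ^ 3\<close>.\<close>
  have n3: "\<not> 3 dvd n"
  proof
    assume "3 dvd n"
    then obtain k where "n = 3 * k"
      by (auto simp: dvd_def)
    then have "x ^ n * (x ^ (3 * (q - 1)) + a) = y ^ n * (y ^ (3 * (q - 1)) + a)"
      using xy(2) by (simp add: power_mult)
    then have "x = y"
      by (rule injD[OF bij_is_inj[OF bij]])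
    with xy(1) show False
      by contradiction
  qed
  from q3 bij show False
    using not_bij_binomial_even_exponent[OF char assms(3,2) _ nq(2) n3 nq(1) assms(5)]
      not_bij_binomial_odd_exponent[OF char assms(3,2) _ _ n3 D Dq assms(5,7)] assms(4)
    by auto
qed

end
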